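(* Let $\xi_1,\ldots,\xi_n$ and $\kappa_1,\ldots,\kappa_m$ ($n,m\ge 1$) be positions such that $\mathcal{M}_{\mathrm{cl}(\xi_i)} \cong \mathcal{M}_{\mathrm{cl}(\kappa_j)} \cong \mathcal{M}_{\mathrm{cl}( * )}$ for all $i\in\{1,\ldots,n\}$, $j\in\{1,\ldots,m\}$. Then: (1) If $o^-(\xi_i)=o^-(\kappa_j)$ for all $i,j$, then $\mathcal{M}_{\mathrm{cl}(\{\xi_1,\ldots,\xi_n \mid \kappa_1,\ldots,\kappa_m\})}\cong \mathcal{M}_{\mathrm{cl}( * )}$. (2) If $o^-(\xi_i)=\mathcal{P}$ for all $i$, then $\mathcal{M}_{\mathrm{cl}(\{\xi_1,\ldots,\xi_n \mid \cdot\})}\cong \mathcal{M}_{\mathrm{cl}( * )}$. (3) If $o^-(\xi_i)=o^-(\kappa_j)=\mathcal{N}$ for all $i,j$, then each of $\mathcal{M}_{\mathrm{cl}(\{\xi_1,\ldots,\xi_n\mid 0\})}$, $\mathcal{M}_{\mathrm{cl}(\{\xi_1,\ldots,\xi_n\mid \kappa_1,\ldots,\kappa_m,0\})}$ and $\mathcal{M}_{\mathrm{cl}(\{\xi_1,\ldots,\xi_n,0\mid \kappa_1,\ldots,\kappa_m,0\})}$ is isomorphic to $\mathcal{M}_{\mathrm{cl}( * )}$. (4) For each $i,j$, $\mathcal{M}_{\mathrm{cl}(\overline{\xi_i})}\cong\mathcal{M}_{\mathrm{cl}(\overline{\kappa_j})}\cong\mathcal{M}_{\mathrm{cl}( * 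)}$.
   Context: A position $\xi=\{\xi^L \mid \xi^R\}$ is given recursively by finite sets of Left and Right options; $\cdot$ denotes an empty option set; $\{\alpha_1,\dots\mid\beta_1,\dots\}$ is the position with the listed Left and Right options. $0=\{\cdot\mid\cdot\}$, $*=\{0\mid 0\}$. The conjugate is $\overline{\xi}=\{\overline{\xi^R}\mid\overline{\xi^L}\}$. Disjunctive sum: $\alpha+\beta=\{\alpha^L+\beta,\alpha+\beta^L \mid \alpha^R+\beta,\alpha+\beta^R\}$. Under misère play a player unable to move on their turn wins; $o^-(\xi)\in\{\mathcal{L},\mathcal{R},\mathcal{N},\mathcal{P}\}$ is the misère outcome (Left wins always / Right wins always / next player wins / next player loses). $\mathrm{cl}(\Upsilon)$ is the smallest set containing $\Upsilon$ closed under disjunctive sum and taking options. For closed $\Gamma$, $\alpha\equiv\beta\pmod\Gamma$ iff $o^-(\alpha+\gamma)=o^-(\beta+\gamma)$ for all $\gamma\in\Gamma$; the misère monoid $\mathcal{M}_\Gamma$ is the quotient monoid (operation induced by $+$, identity the class of $0$) with each class labelled by its members' misère outcome. Isomorphism of misère monoids means a monoid isomorphism which with its inverse preserves outcomes. $\mathcal{M}_{\mathrm{cl}( * )}=\{1,a\}$, $a^2=1$, $1$ of outcome $\mathcal{N}$, $a$ of outcome $\mathcal{P}$. *)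

theory Defs
  imports "HOL-Library.FSet" "HOL-Algebra.Group"
begin

datatype position = Position (left_opts: "position fset") (right_opts: "position fset")

lemma size_fset_member: "x |\<in>| A \<Longrightarrow> f x < size_fset f A"
  using member_le_sum[of x "fset A" "\<lambda>x. Suc (f x)"] by simp

lemma size_left_opts [termination_simp]: "x |\<in>| left_opts p \<Longrightarrow> size x < size p"
  by (cases p) (simp del: size_fset_simps add: size_fset_member trans_less_add1 less_SucI)

lemma size_right_opts [termination_simp]: "x |\<in>| right_opts p \<Longrightarrow> size x < size p"
  by (cases p) (simp del: size_fset_simps add: size_fset_member trans_less_add2 less_SucI)

text \<open>Left options are listed first; the lists stand for the option sets they enumerate.\<close>

definition position_of :: "position list \<Rightarrow> position list \<Rightarrow> position" where
  "position_of ls rs = Position (fset_of_list ls) (fset_of_list rs)"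

instantiation position :: comm_monoid_add
begin

definition zero_position :: position where
  "0 = Position {||} {||}"

function plus_position :: "position \<Rightarrow> position \<Rightarrow> position" where
  "\<alpha> + \<beta> = Position
     ((\<lambda>\<alpha>'. \<alpha>' + \<beta>) |`| left_opts \<alpha> |\<union>| (\<lambda>\<beta>'. \<alpha> + \<beta>') |`| left_opts \<beta>)
     ((\<lambda>\<alpha>'. \<alpha>' + \<beta>) |`| right_opts \<alpha> |\<union>| (\<lambda>\<beta>'. \<alpha> + \<beta>') |`| right_opts \<beta>)"
  by auto
termination
  by (relation "measure (\<lambda>(\<alpha>, \<beta>). size \<alpha> + size \<beta>)") (auto simp: termination_simp)

declare plus_position.simps [simp del]

lemma left_opts_plus: "left_opts (\<alpha> + \<beta>) =
    (\<lambda>\<alpha>'. \<alpha>' + \<beta>) |`| left_opts \<alpha> |\<union>| (\<lambda>\<beta>'. \<alpha> + \<beta>') |`| left_opts \<beta>"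
  and right_opts_plus: "right_opts (\<alpha> + \<beta>) =
    (\<lambda>\<alpha>'. \<alpha>' + \<beta>) |`| right_opts \<alpha> |\<union>| (\<lambda>\<beta>'. \<alpha> + \<beta>') |`| right_opts \<beta>"
  for \<alpha> \<beta> :: position
  by (simp_all add: plus_position.simps[of \<alpha> \<beta>])

instance
proof
  fix \<alpha> \<beta> \<gamma> :: position
  show "\<alpha> + \<beta> + \<gamma> = \<alpha> + (\<beta> + \<gamma>)"
  proof (induction "size \<alpha> + size \<beta> + size \<gamma>" arbitrary: \<alpha> \<beta> \<gamma> rule: less_induct)
    case less
    have "left_opts (\<alpha> + \<beta> + \<gamma>) = left_opts (\<alpha> + (\<beta> + \<gamma>))"
      using less by (auto simp: left_opts_plus funion_assoc fimage_funion fset.map_comp o_def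
          size_left_opts intro!: arg_cong2[of _ _ _ _ "(|\<union>|)"] fset.map_cong)
    moreover have "right_opts (\<alpha> + \<beta> + \<gamma>) = right_opts (\<alpha> + (\<beta> + \<gamma>))"
      using less by (auto simp: right_opts_plus funion_assoc fimage_funion fset.map_comp o_def
          size_right_opts intro!: arg_cong2[of _ _ _ _ "(|\<union>|)"] fset.map_cong)
    ultimately show ?case by (rule position.expand[OF conjI])
  qed
  show "\<alpha> + \<beta> = \<beta> + \<alpha>"
  proof (induction "size \<alpha> + size \<beta>" arbitrary: \<alpha> \<beta> rule: less_induct)
    case less
    have "left_opts (\<alpha> + \<beta>) = left_opts (\<beta> + \<alpha>)"
      unfolding left_opts_plus funion_commute[of "_ |`| left_opts \<beta>"]
      using less by (auto simp: size_left_opts intro!: arg_cong2[of _ _ _ _ "(|\<union>|)"] fset.map_cong)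
    moreover have "right_opts (\<alpha> + \<beta>) = right_opts (\<beta> + \<alpha>)"
      unfolding right_opts_plus funion_commute[of "_ |`| right_opts \<beta>"]
      using less by (auto simp: size_right_opts intro!: arg_cong2[of _ _ _ _ "(|\<union>|)"] fset.map_cong)
    ultimately show ?case by (rule position.expand[OF conjI])
  qed
  show "0 + \<alpha> = \<alpha>"
  proof (induction "size \<alpha>" arbitrary: \<alpha> rule: less_induct)
    case less
    have "left_opts (0 + \<alpha>) = id |`| left_opts \<alpha>"
      using less by (auto simp: left_opts_plus zero_position_def size_left_opts intro!: fset.map_cong)
    moreover have "right_opts (0 + \<alpha>) = id |`| right_opts \<alpha>"
      using less by (auto simp: right_opts_plus zero_position_def size_right_opts intro!: fset.map_cong)
    ultimately show ?case by (intro position.expand) simp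
  qed
qed

end

definition star :: position where
  "star = Position {|0|} {|0|}"

primrec conjugate :: "position \<Rightarrow> position" where
  "conjugate (Position L R) = Position (conjugate |`| R) (conjugate |`| L)"

text \<open>A player with no move available on their own turn wins.\<close>

function left_wins_first :: "position \<Rightarrow> bool" and right_wins_first :: "position \<Rightarrow> bool" where
  "left_wins_first \<xi> \<longleftrightarrow>
     left_opts \<xi> = {||} \<or> (\<exists>\<xi>'|\<in>|left_opts \<xi>. \<not> right_wins_first \<xi>')"
| "right_wins_first \<xi> \<longleftrightarrow>
     right_opts \<xi> = {||} \<or> (\<exists>\<xi>'|\<in>|right_opts \<xi>. \<not> left_wins_first \<xi>')"
  by pat_completeness auto
termination
  by (relation "measure (case_sum size size)") (auto simp: termination_simp)

declare left_wins_first.simps [simp del] right_wins_first.simps [simp del]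

datatype outcome = Out_L | Out_R | Out_N | Out_P

definition misere_outcome :: "position \<Rightarrow> outcome" where
  "misere_outcome \<xi> =
     (if left_wins_first \<xi>
      then if right_wins_first \<xi> then Out_N else Out_L
      else if right_wins_first \<xi> then Out_R else Out_P)"

inductive_set cl :: "position set \<Rightarrow> position set" for \<Upsilon> where
  base: "\<xi> \<in> \<Upsilon> \<Longrightarrow> \<xi> \<in> cl \<Upsilon>"
| sum: "\<alpha> \<in> cl \<Upsilon> \<Longrightarrow> \<beta> \<in> cl \<Upsilon> \<Longrightarrow> \<alpha> + \<beta> \<in> cl \<Upsilon>"
| left_opt: "\<alpha> \<in> cl \<Upsilon> \<Longrightarrow> \<alpha>' |\<in>| left_opts \<alpha> \<Longrightarrow> \<alpha>' \<in> cl \<Upsilon>"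
| right_opt: "\<alpha> \<in> cl \<Upsilon> \<Longrightarrow> \<alpha>' |\<in>| right_opts \<alpha> \<Longrightarrow> \<alpha>' \<in> cl \<Upsilon>"

definition indist :: "position set \<Rightarrow> (position \<times> position) set" where
  "indist \<Gamma> = {(\<alpha>, \<beta>). \<alpha> \<in> \<Gamma> \<and> \<beta> \<in> \<Gamma> \<and>
     (\<forall>\<gamma>\<in>\<Gamma>. misere_outcome (\<alpha> + \<gamma>) = misere_outcome (\<beta> + \<gamma>))}"

record 'a outcome_monoid = "'a monoid" +
  label :: "'a \<Rightarrow> outcome"

text \<open>The multiplication is the one that sends the classes of \<open>\<alpha>\<close> and \<open>\<beta>\<close> to the class of
  \<open>\<alpha> + \<beta>\<close>. For nonempty closed \<open>\<Gamma>\<close> all members of a class have the same outcome, because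
  \<open>0 \<in> \<Gamma>\<close>; \<open>the_elem\<close> extracts this common value.\<close>

definition misere_monoid :: "position set \<Rightarrow> position set outcome_monoid" where
  "misere_monoid \<Gamma> =
     \<lparr>carrier = \<Gamma> // indist \<Gamma>,
      mult = (\<lambda>A B. \<Union>\<alpha>\<in>A. \<Union>\<beta>\<in>B. indist \<Gamma> `` {\<alpha> + \<beta>}),
      one = indist \<Gamma> `` {0},
      label = (\<lambda>A. the_elem (misere_outcome ` A))\<rparr>"

text \<open>Equality of labels along a bijection also covers the inverse map.\<close>

definition outcome_iso :: "('a, 'c) outcome_monoid_scheme \<Rightarrow> ('b, 'd) outcome_monoid_scheme \<Rightarrow> bool"
    (infix "\<cong>\<^sub>o" 50) where
  "M \<cong>\<^sub>o N \<longleftrightarrow> (\<exists>f \<in> iso M N. f \<one>\<^bsub>M\<^esub> = \<one>\<^bsub>N\<^esub> \<and>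
     (\<forall>x \<in> carrier M. label N (f x) = label M x))"

end

theory Submission
  imports Defs
begin

text \<open>Call a position even or odd according to the parity of the length of a maximal sequence of
  moves, alternating or not, if that parity is the same for all of them and neither player is ever
  stuck at an odd position. Even
  positions are won by the next player, odd ones by the previous player, and parities add under
  disjunctive sum, so the closure of such a position has the monoid of \<open>cl {star}\<close>. Conversely,
  if outcomes in a closed set \<open>\<Gamma>\<close> behave like parities, adding a fixed \<open>\<P>\<close>-position turns an
  \<open>\<N>\<close>-position into a \<open>\<P>\<close>-position, all of whose options are \<open>\<N>\<close>-positions; hence every option
  of an \<open>\<N>\<close>-position is a \<open>\<P>\<close>-position. The positions in question are therefore exactly the nonzero
  ones with a parity, and this is a recursive condition that can be read off the options.\<close>

text \<open>The Boolean is \<open>True\<close> for odd positions.\<close>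

inductive has_parity :: "bool \<Rightarrow> position \<Rightarrow> bool" where
  has_parityI: "(\<And>\<xi>'. \<xi>' |\<in>| left_opts \<xi> |\<union>| right_opts \<xi> \<Longrightarrow> has_parity (\<not> b) \<xi>') \<Longrightarrow>
    (b \<Longrightarrow> left_opts \<xi> \<noteq> {||} \<and> right_opts \<xi> \<noteq> {||}) \<Longrightarrow> has_parity b \<xi>"

section \<open>Parity of options and sums, and the outcome it forces\<close>

lemma has_parity_option:
  "has_parity b \<xi> \<Longrightarrow> \<xi>' |\<in>| left_opts \<xi> |\<union>| right_opts \<xi> \<Longrightarrow> has_parity (\<not> b) \<xi>'"
  by (blast elim: has_parity.cases)

lemma has_parity_odd_nonempty:
  "has_parity True \<xi> \<Longrightarrow> left_opts \<xi> \<noteq> {||} \<and> right_opts \<xi> \<noteq> {||}"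
  by (blast elim: has_parity.cases)

lemma has_parity_zero: "has_parity False 0"
  by (rule has_parityI) (auto simp: zero_position_def)

text \<open>A move in a sum changes one component and flips its parity, hence flips
  \<open>b \<noteq> c\<close>. An odd sum has an odd component, and there both players can
  move.\<close>

lemma has_parity_plus:
  "has_parity b \<alpha> \<Longrightarrow> has_parity c \<beta> \<Longrightarrow> has_parity (b \<noteq> c) (\<alpha> + \<beta>)"
proof (induction "size \<alpha> + size \<beta>" arbitrary: \<alpha> \<beta> b c rule: less_induct)
  case less
  show ?case
  proof (rule has_parityI)
    fix \<xi> assume "\<xi> |\<in>| left_opts (\<alpha> + \<beta>) |\<union>| right_opts (\<alpha> + \<beta>)"
    then consider \<alpha>' where "\<alpha>' |\<in>| left_opts \<alpha> |\<union>| right_opts \<alpha>" "\<xi> = \<alpha>' + \<beta>"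
      | \<beta>' where "\<beta>' |\<in>| left_opts \<beta> |\<union>| right_opts \<beta>" "\<xi> = \<alpha> + \<beta>'"
      by (auto simp: left_opts_plus right_opts_plus)
    then show "has_parity (\<not> (b \<noteq> c)) \<xi>"
    proof cases
      case 1
      then have "size \<alpha>' < size \<alpha>" by (auto simp: size_left_opts size_right_opts)
      then show ?thesis
        using less.hyps[of \<alpha>' \<beta> "\<not> b" c] 1 less.prems by (auto dest: has_parity_option)
    next
      case 2
      then have "size \<beta>' < size \<beta>" by (auto simp: size_left_opts size_right_opts)
      then show ?thesis
        using less.hyps[of \<alpha> \<beta>' b "\<not> c"] 2 less.prems by (auto dest: has_parity_option)
    qed
  next
    assume "b \<noteq> c"
    then have "has_parity True \<alpha> \<or> has_parity True \<beta>"
      using less.prems by (cases b) auto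
    then show "left_opts (\<alpha> + \<beta>) \<noteq> {||} \<and> right_opts (\<alpha> + \<beta>) \<noteq> {||}"
      by (auto simp: left_opts_plus right_opts_plus dest: has_parity_odd_nonempty)
  qed
qed

text \<open>The choice of moves is irrelevant. From an odd position a move exists and every move
  hands the opponent an even one. At an even position the mover is either stuck, which wins under
  misere play, or must move to an odd position.\<close>

lemma has_parity_wins_first:
  "has_parity b \<xi> \<Longrightarrow> (left_wins_first \<xi> \<longleftrightarrow> \<not> b) \<and> (right_wins_first \<xi> \<longleftrightarrow> \<not> b)"
proof (induction rule: has_parity.induct)
  case (has_parityI \<xi> b)
  then show ?case
    unfolding left_wins_first.simps[of \<xi>] right_wins_first.simps[of \<xi>] by auto
qed

lemma misere_outcome_has_parity:
  "has_parity b \<xi> \<Longrightarrow> misere_outcome \<xi> = (if b then Out_P else Out_N)"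
  using has_parity_wins_first[of b \<xi>] by (auto simp: misere_outcome_def)

section \<open>Conjugates and the zero position\<close>

lemma left_opts_conjugate: "left_opts (conjugate \<xi>) = conjugate |`| right_opts \<xi>"
  and right_opts_conjugate: "right_opts (conjugate \<xi>) = conjugate |`| left_opts \<xi>"
  by (cases \<xi>; simp)+

text \<open>The conditions defining parity are symmetric in Left and Right.\<close>

lemma has_parity_conjugate: "has_parity b \<xi> \<Longrightarrow> has_parity b (conjugate \<xi>)"
proof (induction rule: has_parity.induct)
  case (has_parityI \<xi> b)
  show ?case
    by (rule has_parity.has_parityI)
      (use has_parityI in \<open>auto simp: left_opts_conjugate right_opts_conjugate\<close>)
qed

lemma eq_zero_iff: "\<xi> = 0 \<longleftrightarrow> left_opts \<xi> = {||} \<and> right_opts \<xi> = {||}"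
  by (cases \<xi>) (auto simp: zero_position_def)

lemma conjugate_eq_zero_iff: "conjugate \<xi> = 0 \<longleftrightarrow> \<xi> = 0"
  by (auto simp: eq_zero_iff left_opts_conjugate right_opts_conjugate)

section \<open>The misere monoid of a closed set of positions\<close>

locale closed_positions =
  fixes \<Gamma> :: "position set"
  assumes nonempty: "\<Gamma> \<noteq> {}"
    and plus_closed: "\<alpha> \<in> \<Gamma> \<Longrightarrow> \<beta> \<in> \<Gamma> \<Longrightarrow> \<alpha> + \<beta> \<in> \<Gamma>"
    and option_closed: "\<alpha> \<in> \<Gamma> \<Longrightarrow> \<alpha>' |\<in>| left_opts \<alpha> |\<union>| right_opts \<alpha> \<Longrightarrow> \<alpha>' \<in> \<Gamma>"
begin

text \<open>Passing to options from any member, by either player's moves, decreases the size and can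
  stop only at \<open>0\<close>.\<close>

lemma zero_closed: "0 \<in> \<Gamma>"
proof -
  have "\<alpha> \<in> \<Gamma> \<Longrightarrow> 0 \<in> \<Gamma>" for \<alpha>
  proof (induction "size \<alpha>" arbitrary: \<alpha> rule: less_induct)
    case less
    show ?case
    proof (cases "\<alpha> = 0")
      case False
      then obtain \<alpha>' where "\<alpha>' |\<in>| left_opts \<alpha> |\<union>| right_opts \<alpha>"
        by (auto simp: eq_zero_iff)
      then have "size \<alpha>' < size \<alpha>" "\<alpha>' \<in> \<Gamma>"
        using less.prems option_closed by (auto simp: size_left_opts size_right_opts)
      then show ?thesis by (rule less.hyps)
    qed (use less in simp)
  qed
  then show ?thesis using nonempty by blast
qed

lemma equiv_indist: "equiv \<Gamma> (indist \<Gamma>)"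
  by (auto simp: indist_def equiv_def refl_on_def sym_def trans_def)

lemma indist_outcome: "(\<alpha>, \<beta>) \<in> indist \<Gamma> \<Longrightarrow> misere_outcome \<alpha> = misere_outcome \<beta>"
  using zero_closed by (fastforce simp: indist_def)

text \<open>The summands are exchanged one at a time: the other summand is absorbed into the test
  position, which stays in \<open>\<Gamma>\<close> because \<open>\<Gamma>\<close> is closed under
  sums.\<close>

lemma indist_plus:
  assumes "(\<alpha>, \<alpha>') \<in> indist \<Gamma>" and "(\<beta>, \<beta>') \<in> indist \<Gamma>"
  shows "(\<alpha> + \<beta>, \<alpha>' + \<beta>') \<in> indist \<Gamma>"
proof -
  have "misere_outcome (\<alpha> + \<beta> + \<gamma>) = misere_outcome (\<alpha>' + \<beta>' + \<gamma>)" if "\<gamma> \<in> \<Gamma>" for \<gamma>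
  proof -
    have "misere_outcome (\<alpha> + (\<beta> + \<gamma>)) = misere_outcome (\<alpha>' + (\<beta> + \<gamma>))"
      using assms that by (auto simp: indist_def plus_closed)
    moreover have "misere_outcome (\<beta> + (\<alpha>' + \<gamma>)) = misere_outcome (\<beta>' + (\<alpha>' + \<gamma>))"
      using assms that by (auto simp: indist_def plus_closed)
    ultimately show ?thesis by (simp add: ac_simps)
  qed
  then show ?thesis using assms by (auto simp: indist_def plus_closed)
qed

lemma carrier_misere_monoid: "carrier (misere_monoid \<Gamma>) = (\<lambda>\<alpha>. indist \<Gamma> `` {\<alpha>}) ` \<Gamma>"
  by (auto simp: misere_monoid_def quotient_def)

lemma one_misere_monoid: "\<one>\<^bsub>misere_monoid \<Gamma>\<^esub> = indist \<Gamma> `` {0}"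
  by (simp add: misere_monoid_def)

text \<open>By \<open>indist_plus\<close> the union defining the product runs over copies of a
  single class, and its index sets are nonempty.\<close>

lemma mult_misere_monoid:
  assumes "\<alpha> \<in> \<Gamma>" and "\<beta> \<in> \<Gamma>"
  shows "indist \<Gamma> `` {\<alpha>} \<otimes>\<^bsub>misere_monoid \<Gamma>\<^esub> indist \<Gamma> `` {\<beta>} = indist \<Gamma> `` {\<alpha> + \<beta>}"
proof -
  have "indist \<Gamma> `` {\<alpha>' + \<beta>'} = indist \<Gamma> `` {\<alpha> + \<beta>}"
    if "\<alpha>' \<in> indist \<Gamma> `` {\<alpha>}" "\<beta>' \<in> indist \<Gamma> `` {\<beta>}" for \<alpha>' \<beta>'
    using equiv_class_eq[OF equiv_indist indist_plus] that by blast
  then have "indist \<Gamma> `` {\<alpha>} \<otimes>\<^bsub>misere_monoid \<Gamma>\<^esub> indist \<Gamma> `` {\<beta>} =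
      (\<Union>\<alpha>'\<in>indist \<Gamma> `` {\<alpha>}. \<Union>\<beta>'\<in>indist \<Gamma> `` {\<beta>}. indist \<Gamma> `` {\<alpha> + \<beta>})"
    unfolding misere_monoid_def monoid.simps by (intro SUP_cong refl)
  moreover have "\<alpha> \<in> indist \<Gamma> `` {\<alpha>}" "\<beta> \<in> indist \<Gamma> `` {\<beta>}"
    using assms equiv_class_self[OF equiv_indist] by blast+
  ultimately show ?thesis by auto
qed

lemma label_misere_monoid:
  assumes "\<alpha> \<in> \<Gamma>"
  shows "label (misere_monoid \<Gamma>) (indist \<Gamma> `` {\<alpha>}) = misere_outcome \<alpha>"
proof -
  have "misere_outcome ` (indist \<Gamma> `` {\<alpha>}) = {misere_outcome \<alpha>}"
  proof
    show "misere_outcome ` (indist \<Gamma> `` {\<alpha>}) \<subseteq> {misere_outcome \<alpha>}"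
      by (auto dest: indist_outcome)
  qed (use equiv_class_self[OF equiv_indist assms] in blast)
  then show ?thesis by (simp add: misere_monoid_def)
qed

end

lemma closed_positions_cl: "\<Upsilon> \<noteq> {} \<Longrightarrow> closed_positions (cl \<Upsilon>)"
  by standard (auto intro: cl.intros)

section \<open>Closed sets whose outcomes add like parities\<close>

text \<open>For a nonempty closed \<open>\<Gamma>\<close> this makes the outcome an additive map
  onto the group of order two, with \<open>Out_N\<close> as identity. Speaking of positions rather
  than classes makes it directly applicable to moves and sums.\<close>

definition parity_outcomes :: "position set \<Rightarrow> bool" where
  "parity_outcomes \<Gamma> \<longleftrightarrow>
     (\<forall>\<alpha>\<in>\<Gamma>. misere_outcome \<alpha> \<in> {Out_N, Out_P}) \<and>
     (\<forall>\<alpha>\<in>\<Gamma>. \<forall>\<beta>\<in>\<Gamma>. misere_outcome (\<alpha> + \<beta>) =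
        (if misere_outcome \<alpha> = misere_outcome \<beta> then Out_N else Out_P)) \<and>
     (\<exists>\<alpha>\<in>\<Gamma>. misere_outcome \<alpha> = Out_P)"

context closed_positions
begin

text \<open>The condition depends only on labels of classes and of their products, so it can be
  pulled back along an isomorphism preserving labels.\<close>

lemma parity_outcomes_transfer:
  assumes "closed_positions \<Delta>" and "parity_outcomes \<Delta>"
    and iso: "misere_monoid \<Gamma> \<cong>\<^sub>o misere_monoid \<Delta>"
  shows "parity_outcomes \<Gamma>"
proof -
  interpret D: closed_positions \<Delta> by fact
  obtain f where f: "f \<in> iso (misere_monoid \<Gamma>) (misere_monoid \<Delta>)"
    and lab: "\<And>x. x \<in> carrier (misere_monoid \<Gamma>) \<Longrightarrow>
      label (misere_monoid \<Delta>) (f x) = label (misere_monoid \<Gamma>) x"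
    using iso unfolding outcome_iso_def by blast
  have bij: "bij_betw f (carrier (misere_monoid \<Gamma>)) (carrier (misere_monoid \<Delta>))"
    and hom: "f \<in> hom (misere_monoid \<Gamma>) (misere_monoid \<Delta>)"
    using f by (auto simp: iso_def)
  \<comment> \<open>The map \<open>g\<close> to be chosen lifts \<open>f\<close> from classes to
    representatives.\<close>
  have "\<exists>\<delta>. \<delta> \<in> \<Delta> \<and> f (indist \<Gamma> `` {\<alpha>}) = indist \<Delta> `` {\<delta>}" if "\<alpha> \<in> \<Gamma>" for \<alpha>
    using bij_betwE[OF bij] that by (auto simp: carrier_misere_monoid D.carrier_misere_monoid)
  then obtain g where g: "\<And>\<alpha>. \<alpha> \<in> \<Gamma> \<Longrightarrow> g \<alpha> \<in> \<Delta>"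
    and fg: "\<And>\<alpha>. \<alpha> \<in> \<Gamma> \<Longrightarrow> f (indist \<Gamma> `` {\<alpha>}) = indist \<Delta> `` {g \<alpha>}"
    by metis
  have out: "misere_outcome (g \<alpha>) = misere_outcome \<alpha>" if "\<alpha> \<in> \<Gamma>" for \<alpha>
    using lab[of "indist \<Gamma> `` {\<alpha>}"] that
    by (simp add: carrier_misere_monoid fg g label_misere_monoid D.label_misere_monoid)
  have add: "misere_outcome (\<alpha> + \<beta>) = misere_outcome (g \<alpha> + g \<beta>)"
    if "\<alpha> \<in> \<Gamma>" "\<beta> \<in> \<Gamma>" for \<alpha> \<beta>
  proof -
    have "f (indist \<Gamma> `` {\<alpha> + \<beta>}) = indist \<Delta> `` {g \<alpha> + g \<beta>}"
      using hom_mult[OF hom, of "indist \<Gamma> `` {\<alpha>}" "indist \<Gamma> `` {\<beta>}"] that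
      by (simp add: carrier_misere_monoid mult_misere_monoid D.mult_misere_monoid fg g)
    then show ?thesis
      using lab[of "indist \<Gamma> `` {\<alpha> + \<beta>}"] that
      by (simp add: carrier_misere_monoid label_misere_monoid D.label_misere_monoid
          g plus_closed D.plus_closed)
  qed
  \<comment> \<open>Surjectivity of \<open>f\<close> is used to find a position of outcome
    \<open>Out_P\<close> in \<open>\<Gamma>\<close>.\<close>
  obtain \<delta> where \<delta>: "\<delta> \<in> \<Delta>" "misere_outcome \<delta> = Out_P"
    using assms by (auto simp: parity_outcomes_def)
  then have "indist \<Delta> `` {\<delta>} \<in> f ` carrier (misere_monoid \<Gamma>)"
    unfolding bij_betw_imp_surj_on[OF bij] D.carrier_misere_monoid by blast
  then obtain \<alpha> where \<alpha>: "\<alpha> \<in> \<Gamma>" "f (indist \<Gamma> `` {\<alpha>}) = indist \<Delta> `` {\<delta>}"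
    unfolding carrier_misere_monoid by fastforce
  then have "misere_outcome \<alpha> = Out_P"
    using \<delta> lab[of "indist \<Gamma> `` {\<alpha>}"]
    by (simp add: carrier_misere_monoid label_misere_monoid D.label_misere_monoid)
  then show ?thesis
    using assms(2) \<alpha>(1) out add g unfolding parity_outcomes_def by metis
qed

text \<open>The outcome of a sum depends only on the outcomes of the summands, so no test position
  separates members of equal outcome.\<close>

lemma indist_class_outcome:
  assumes "parity_outcomes \<Gamma>" and "\<alpha> \<in> \<Gamma>"
  shows "indist \<Gamma> `` {\<alpha>} = {\<beta> \<in> \<Gamma>. misere_outcome \<beta> = misere_outcome \<alpha>}"
proof (intro equalityI subsetI)
  fix \<beta> assume "\<beta> \<in> indist \<Gamma> `` {\<alpha>}"
  then show "\<beta> \<in> {\<beta> \<in> \<Gamma>. misere_outcome \<beta> = misere_outcome \<alpha>}"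
    using indist_outcome[of \<alpha> \<beta>] by (auto simp: indist_def)
qed (use assms in \<open>simp add: indist_def parity_outcomes_def\<close>)

text \<open>Each monoid has exactly two classes, one per outcome; matching classes of equal label
  respects the product, since the product is determined by the labels.\<close>

lemma outcome_iso_parity:
  assumes "closed_positions \<Delta>" and \<Gamma>: "parity_outcomes \<Gamma>" and \<Delta>: "parity_outcomes \<Delta>"
  shows "misere_monoid \<Gamma> \<cong>\<^sub>o misere_monoid \<Delta>"
proof -
  interpret D: closed_positions \<Delta> by fact
  \<comment> \<open>The image is written as a set of positions with prescribed outcome, so no
    representative has to be chosen; \<open>indist_class_outcome\<close> shows that it is a
    class.\<close>
  define f where "f A = {\<delta> \<in> \<Delta>. misere_outcome \<delta> = label (misere_monoid \<Gamma>) A}" for A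
  have f: "f (indist \<Gamma> `` {\<alpha>}) = indist \<Delta> `` {\<delta>}"
    if "\<alpha> \<in> \<Gamma>" "\<delta> \<in> \<Delta>" "misere_outcome \<alpha> = misere_outcome \<delta>" for \<alpha> \<delta>
    using that by (simp add: f_def label_misere_monoid D.indist_class_outcome[OF \<Delta>])
  have zero: "misere_outcome 0 = Out_N"
    by (simp add: misere_outcome_has_parity[OF has_parity_zero])
  \<comment> \<open>Outcome \<open>Out_N\<close> is realised by \<open>0\<close>, outcome
    \<open>Out_P\<close> by the last clause of \<open>parity_outcomes\<close>.\<close>
  have match: "\<exists>\<delta>\<in>\<Delta>. misere_outcome \<alpha> = misere_outcome \<delta>" if "\<alpha> \<in> \<Gamma>" for \<alpha>
    using that \<Gamma> \<Delta> zero D.zero_closed unfolding parity_outcomes_def by (metis insertE singletonD)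
  have match': "\<exists>\<alpha>\<in>\<Gamma>. misere_outcome \<alpha> = misere_outcome \<delta>" if "\<delta> \<in> \<Delta>" for \<delta>
    using that \<Gamma> \<Delta> zero zero_closed unfolding parity_outcomes_def by (metis insertE singletonD)
  have lab: "label (misere_monoid \<Delta>) (f A) = label (misere_monoid \<Gamma>) A"
    if A: "A \<in> carrier (misere_monoid \<Gamma>)" for A
  proof -
    obtain \<alpha> \<delta> where "A = indist \<Gamma> `` {\<alpha>}" "\<alpha> \<in> \<Gamma>" "\<delta> \<in> \<Delta>" "misere_outcome \<alpha> = misere_outcome \<delta>"
      using A match unfolding carrier_misere_monoid by blast
    then show ?thesis by (simp add: f label_misere_monoid D.label_misere_monoid)
  qed
  have closed: "f A \<in> carrier (misere_monoid \<Delta>)" if A: "A \<in> carrier (misere_monoid \<Gamma>)" for A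
  proof -
    obtain \<alpha> \<delta> where "A = indist \<Gamma> `` {\<alpha>}" "\<alpha> \<in> \<Gamma>" "\<delta> \<in> \<Delta>" "misere_outcome \<alpha> = misere_outcome \<delta>"
      using A match unfolding carrier_misere_monoid by blast
    then show ?thesis by (simp add: f D.carrier_misere_monoid)
  qed
  have "f \<in> hom (misere_monoid \<Gamma>) (misere_monoid \<Delta>)"
  proof (rule homI[OF closed])
    fix A B
    assume "A \<in> carrier (misere_monoid \<Gamma>)" "B \<in> carrier (misere_monoid \<Gamma>)"
    then obtain \<alpha> \<beta> where \<alpha>: "A = indist \<Gamma> `` {\<alpha>}" "\<alpha> \<in> \<Gamma>" and \<beta>: "B = indist \<Gamma> `` {\<beta>}" "\<beta> \<in> \<Gamma>"
      by (auto simp: carrier_misere_monoid)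
    obtain \<gamma> \<delta> where \<gamma>: "\<gamma> \<in> \<Delta>" "misere_outcome \<alpha> = misere_outcome \<gamma>"
      and \<delta>: "\<delta> \<in> \<Delta>" "misere_outcome \<beta> = misere_outcome \<delta>"
      using match \<alpha> \<beta> by meson
    have "misere_outcome (\<alpha> + \<beta>) = misere_outcome (\<gamma> + \<delta>)"
      using \<Gamma> \<Delta> \<alpha> \<beta> \<gamma> \<delta> by (simp add: parity_outcomes_def)
    then show "f (A \<otimes>\<^bsub>misere_monoid \<Gamma>\<^esub> B) = f A \<otimes>\<^bsub>misere_monoid \<Delta>\<^esub> f B"
      using \<alpha> \<beta> \<gamma> \<delta>
      by (simp add: f mult_misere_monoid D.mult_misere_monoid plus_closed D.plus_closed)
  qed
  moreover have "inj_on f (carrier (misere_monoid \<Gamma>))"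
  proof (rule inj_onI)
    fix A B
    assume AB: "A \<in> carrier (misere_monoid \<Gamma>)" "B \<in> carrier (misere_monoid \<Gamma>)" "f A = f B"
    then obtain \<alpha> \<beta> where \<alpha>: "A = indist \<Gamma> `` {\<alpha>}" "\<alpha> \<in> \<Gamma>" and \<beta>: "B = indist \<Gamma> `` {\<beta>}" "\<beta> \<in> \<Gamma>"
      by (auto simp: carrier_misere_monoid)
    \<comment> \<open>\<open>f\<close> preserves labels, and a label determines its class.\<close>
    have "misere_outcome \<alpha> = misere_outcome \<beta>"
      using lab[OF AB(1)] lab[OF AB(2)] AB(3) \<alpha> \<beta> by (simp add: label_misere_monoid)
    then show "A = B" using \<alpha> \<beta> by (simp add: indist_class_outcome[OF \<Gamma>])
  qed
  moreover have "f ` carrier (misere_monoid \<Gamma>) = carrier (misere_monoid \<Delta>)"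
  proof
    show "carrier (misere_monoid \<Delta>) \<subseteq> f ` carrier (misere_monoid \<Gamma>)"
    proof
      fix B assume "B \<in> carrier (misere_monoid \<Delta>)"
      then obtain \<alpha> \<delta> where "B = indist \<Delta> `` {\<delta>}" "\<alpha> \<in> \<Gamma>" "\<delta> \<in> \<Delta>"
        "misere_outcome \<alpha> = misere_outcome \<delta>"
        using match' unfolding D.carrier_misere_monoid by blast
      then have "B = f (indist \<Gamma> `` {\<alpha>})" by (simp add: f)
      then show "B \<in> f ` carrier (misere_monoid \<Gamma>)"
        using \<open>\<alpha> \<in> \<Gamma>\<close> by (simp add: carrier_misere_monoid)
    qed
  qed (use closed in blast)
  ultimately have "f \<in> iso (misere_monoid \<Gamma>) (misere_monoid \<Delta>)"
    by (simp add: iso_def bij_betw_def)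
  moreover have "f \<one>\<^bsub>misere_monoid \<Gamma>\<^esub> = \<one>\<^bsub>misere_monoid \<Delta>\<^esub>"
    by (simp add: f one_misere_monoid D.one_misere_monoid zero_closed D.zero_closed)
  ultimately show ?thesis using lab unfolding outcome_iso_def by blast
qed

text \<open>Adding a \<open>\<beta>\<close> of the opposite outcome makes
  \<open>\<alpha> + \<beta>\<close> a P-position, whose options reveal the outcomes of the options
  of \<open>\<alpha>\<close>. This treats both outcomes of \<open>\<alpha>\<close> at once.\<close>

lemma parity_outcomes_imp_has_parity:
  assumes \<Gamma>: "parity_outcomes \<Gamma>" and "\<alpha> \<in> \<Gamma>"
  shows "has_parity (misere_outcome \<alpha> = Out_P) \<alpha>"
  using assms(2)
proof (induction "size \<alpha>" arbitrary: \<alpha> rule: less_induct)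
  case less
  have NP: "misere_outcome \<gamma> = Out_N \<or> misere_outcome \<gamma> = Out_P" if "\<gamma> \<in> \<Gamma>" for \<gamma>
    using \<Gamma> that by (auto simp: parity_outcomes_def)
  have add: "misere_outcome (\<gamma> + \<delta>) =
      (if misere_outcome \<gamma> = misere_outcome \<delta> then Out_N else Out_P)"
    if "\<gamma> \<in> \<Gamma>" "\<delta> \<in> \<Gamma>" for \<gamma> \<delta>
    using \<Gamma> that by (simp add: parity_outcomes_def)
  \<comment> \<open>Both outcomes occur in \<open>\<Gamma>\<close>, that of \<open>0\<close> being
    \<open>Out_N\<close>, so one of them differs from the outcome of
    \<open>\<alpha>\<close>.\<close>
  have "\<exists>\<beta>\<in>\<Gamma>. misere_outcome \<beta> \<noteq> misere_outcome \<alpha>"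
    using \<Gamma> zero_closed misere_outcome_has_parity[OF has_parity_zero]
    unfolding parity_outcomes_def by (metis outcome.distinct(11))
  then obtain \<beta> where \<beta>: "\<beta> \<in> \<Gamma>" "misere_outcome \<beta> \<noteq> misere_outcome \<alpha>" by blast
  then have P: "misere_outcome (\<alpha> + \<beta>) = Out_P"
    using less.prems add by auto
  show ?case
  proof (rule has_parityI)
    fix \<alpha>' assume \<alpha>': "\<alpha>' |\<in>| left_opts \<alpha> |\<union>| right_opts \<alpha>"
    then have mem: "\<alpha>' \<in> \<Gamma>" and size: "size \<alpha>' < size \<alpha>"
      using less.prems option_closed by (auto simp: size_left_opts size_right_opts)
    have "\<alpha>' + \<beta> |\<in>| left_opts (\<alpha> + \<beta>) \<or> \<alpha>' + \<beta> |\<in>| right_opts (\<alpha> + \<beta>)"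
      using \<alpha>' by (auto simp: left_opts_plus right_opts_plus)
    moreover have "\<not> left_wins_first (\<alpha> + \<beta>)" "\<not> right_wins_first (\<alpha> + \<beta>)"
      using P by (auto simp: misere_outcome_def split: if_splits)
    \<comment> \<open>A move from a P-position gives the opponent a won turn, so
      \<open>\<alpha>' + \<beta>\<close> is not a P-position. By additivity \<open>\<alpha>'\<close>
      then shares the outcome of \<open>\<beta>\<close>, opposite to that of
      \<open>\<alpha>\<close>.\<close>
    ultimately have "right_wins_first (\<alpha>' + \<beta>) \<or> left_wins_first (\<alpha>' + \<beta>)"
      unfolding left_wins_first.simps[of "\<alpha> + \<beta>"] right_wins_first.simps[of "\<alpha> + \<beta>"] by blast
    then have "misere_outcome (\<alpha>' + \<beta>) \<noteq> Out_P"
      by (auto simp: misere_outcome_def)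
    then have "misere_outcome \<alpha>' = misere_outcome \<beta>"
      using add[OF mem \<beta>(1)] by (simp split: if_splits)
    then have "(misere_outcome \<alpha>' = Out_P) = (misere_outcome \<alpha> \<noteq> Out_P)"
      using NP[OF less.prems] NP[OF \<beta>(1)] \<beta>(2) by auto
    then show "has_parity (misere_outcome \<alpha> \<noteq> Out_P) \<alpha>'"
      using less.hyps[OF size mem] by simp
  next
    \<comment> \<open>A stuck mover would win, so neither player is stuck at a P-position.\<close>
    assume "misere_outcome \<alpha> = Out_P"
    then have "\<not> left_wins_first \<alpha>" "\<not> right_wins_first \<alpha>"
      by (auto simp: misere_outcome_def split: if_splits)
    then show "left_opts \<alpha> \<noteq> {||} \<and> right_opts \<alpha> \<noteq> {||}"
      unfolding left_wins_first.simps[of \<alpha>] right_wins_first.simps[of \<alpha>] by blast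
  qed
qed

end

section \<open>Closures of single positions and the characterization\<close>

lemma has_parity_cl:
  assumes "\<alpha> \<in> cl \<Upsilon>" and "\<And>\<xi>. \<xi> \<in> \<Upsilon> \<Longrightarrow> \<exists>b. has_parity b \<xi>"
  shows "\<exists>b. has_parity b \<alpha>"
  using assms(1)
proof (induction rule: cl.induct)
  case (sum \<alpha> \<beta>)
  then show ?case using has_parity_plus by blast
next
  case (left_opt \<alpha> \<alpha>')
  then show ?case using has_parity_option by blast
next
  case (right_opt \<alpha> \<alpha>')
  then show ?case using has_parity_option by blast
qed (use assms(2) in blast)

lemma parity_outcomes_cl_singleton_iff:
  "parity_outcomes (cl {\<xi>}) \<longleftrightarrow> \<xi> \<noteq> 0 \<and> (\<exists>b. has_parity b \<xi>)"
proof
  assume *: "parity_outcomes (cl {\<xi>})"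
  interpret closed_positions "cl {\<xi>}" by (rule closed_positions_cl) simp
  \<comment> \<open>The closure of \<open>0\<close> contains nothing else, hence no position of
    outcome \<open>Out_P\<close>.\<close>
  have "\<alpha> = 0" if "\<alpha> \<in> cl {0}" for \<alpha>
    using that by induction (use eq_zero_iff[of 0] in auto)
  then have "\<xi> \<noteq> 0"
    using * misere_outcome_has_parity[OF has_parity_zero] by (force simp: parity_outcomes_def)
  moreover have "\<exists>b. has_parity b \<xi>"
    using parity_outcomes_imp_has_parity[OF *] by (blast intro: cl.base)
  ultimately show "\<xi> \<noteq> 0 \<and> (\<exists>b. has_parity b \<xi>)" by blast
next
  assume *: "\<xi> \<noteq> 0 \<and> (\<exists>b. has_parity b \<xi>)"
  then obtain b where b: "has_parity b \<xi>" by blast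
  \<comment> \<open>A move flips parity, so one of \<open>\<xi>\<close> and \<open>\<xi>'\<close> is
    odd and supplies outcome \<open>Out_P\<close>. This is where \<open>\<xi> \<noteq> 0\<close>
    enters.\<close>
  obtain \<xi>' where \<xi>': "\<xi>' |\<in>| left_opts \<xi> |\<union>| right_opts \<xi>"
    using * by (auto simp: eq_zero_iff)
  have mem: "\<xi> \<in> cl {\<xi>}" "\<xi>' \<in> cl {\<xi>}"
    using \<xi>' by (auto intro: cl.intros)
  have "misere_outcome (if b then \<xi> else \<xi>') = Out_P"
    using misere_outcome_has_parity[OF b]
      misere_outcome_has_parity[OF has_parity_option[OF b \<xi>']] by simp
  then have P: "\<exists>\<alpha>\<in>cl {\<xi>}. misere_outcome \<alpha> = Out_P"
    using mem by (auto split: if_splits)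
  have par: "\<exists>b. has_parity b \<alpha>" if "\<alpha> \<in> cl {\<xi>}" for \<alpha>
    using has_parity_cl[OF that] b by blast
  have "misere_outcome \<alpha> \<in> {Out_N, Out_P}" if "\<alpha> \<in> cl {\<xi>}" for \<alpha>
    using par[OF that] misere_outcome_has_parity by auto
  moreover have "misere_outcome (\<alpha> + \<beta>) =
      (if misere_outcome \<alpha> = misere_outcome \<beta> then Out_N else Out_P)"
    if \<alpha>: "\<alpha> \<in> cl {\<xi>}" and \<beta>: "\<beta> \<in> cl {\<xi>}" for \<alpha> \<beta>
  proof -
    obtain c d where "has_parity c \<alpha>" "has_parity d \<beta>"
      using par \<alpha> \<beta> by blast
    then show ?thesis
      using has_parity_plus[of c \<alpha> d \<beta>] by (auto simp: misere_outcome_has_parity)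
  qed
  ultimately show "parity_outcomes (cl {\<xi>})"
    using P by (simp add: parity_outcomes_def)
qed

text \<open>\<open>star\<close> is nonzero and odd, so \<open>cl {star}\<close> satisfies
  \<open>parity_outcomes\<close>. Transfer along an isomorphism gives one direction, and the
  isomorphism between any two such closed sets gives the other.\<close>

theorem misere_monoid_iso_star_iff:
  "misere_monoid (cl {\<xi>}) \<cong>\<^sub>o misere_monoid (cl {star}) \<longleftrightarrow> \<xi> \<noteq> 0 \<and> (\<exists>b. has_parity b \<xi>)"
proof -
  have "has_parity True star"
    by (rule has_parityI) (auto simp: star_def has_parity_zero)
  moreover have "star \<noteq> 0" by (simp add: star_def zero_position_def)
  ultimately have "parity_outcomes (cl {star})"
    by (auto simp: parity_outcomes_cl_singleton_iff)
  then have "misere_monoid (cl {\<xi>}) \<cong>\<^sub>o misere_monoid (cl {star}) \<longleftrightarrow> parity_outcomes (cl {\<xi>})"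
    using closed_positions.outcome_iso_parity closed_positions.parity_outcomes_transfer
      closed_positions_cl by (metis insert_not_empty)
  then show ?thesis by (simp add: parity_outcomes_cl_singleton_iff)
qed

section \<open>Positions given by lists of options\<close>

lemma position_of_has_parity:
  assumes "\<And>\<xi>. \<xi> \<in> set ls \<union> set rs \<Longrightarrow> has_parity (\<not> b) \<xi>"
    and "b \<Longrightarrow> ls \<noteq> [] \<and> rs \<noteq> []"
  shows "has_parity b (position_of ls rs)"
proof (rule has_parityI)
  show "left_opts (position_of ls rs) \<noteq> {||} \<and> right_opts (position_of ls rs) \<noteq> {||}" if b
    using assms(2)[OF that] by (cases ls; cases rs) (auto simp: position_of_def)
qed (use assms(1) in \<open>auto simp: position_of_def fset_of_list_elem\<close>)

lemma position_of_eq_zero_iff: "position_of ls rs = 0 \<longleftrightarrow> ls = [] \<and> rs = []"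
  by (cases ls; cases rs) (auto simp: position_of_def zero_position_def)

theorem theorem7p3p9:
  fixes \<xi>s \<kappa>s :: "position list"
  assumes "\<xi>s \<noteq> []" and "\<kappa>s \<noteq> []"
    and "\<forall>\<xi>\<in>set \<xi>s. misere_monoid (cl {\<xi>}) \<cong>\<^sub>o misere_monoid (cl {star})"
    and "\<forall>\<kappa>\<in>set \<kappa>s. misere_monoid (cl {\<kappa>}) \<cong>\<^sub>o misere_monoid (cl {star})"
  shows
    "((\<forall>\<xi>\<in>set \<xi>s. \<forall>\<kappa>\<in>set \<kappa>s. misere_outcome \<xi> = misere_outcome \<kappa>) \<longrightarrow>
        misere_monoid (cl {position_of \<xi>s \<kappa>s}) \<cong>\<^sub>o misere_monoid (cl {star})) \<and>
     ((\<forall>\<xi>\<in>set \<xi>s. misere_outcome \<xi> = Out_P) \<longrightarrow>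
        misere_monoid (cl {position_of \<xi>s []}) \<cong>\<^sub>o misere_monoid (cl {star})) \<and>
     ((\<forall>\<xi>\<in>set \<xi>s. \<forall>\<kappa>\<in>set \<kappa>s. misere_outcome \<xi> = Out_N \<and> misere_outcome \<kappa> = Out_N) \<longrightarrow>
        misere_monoid (cl {position_of \<xi>s [0]}) \<cong>\<^sub>o misere_monoid (cl {star}) \<and>
        misere_monoid (cl {position_of \<xi>s (\<kappa>s @ [0])}) \<cong>\<^sub>o misere_monoid (cl {star}) \<and>
        misere_monoid (cl {position_of (\<xi>s @ [0]) (\<kappa>s @ [0])}) \<cong>\<^sub>o misere_monoid (cl {star})) \<and>
     (\<forall>\<xi>\<in>set \<xi>s. \<forall>\<kappa>\<in>set \<kappa>s.
        misere_monoid (cl {conjugate \<xi>}) \<cong>\<^sub>o misere_monoid (cl {star}) \<and>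
        misere_monoid (cl {conjugate \<kappa>}) \<cong>\<^sub>o misere_monoid (cl {star}))"
proof -
  have par: "has_parity (misere_outcome \<xi> = Out_P) \<xi>"
    and nonzero: "\<xi> \<noteq> 0" if "\<xi> \<in> set \<xi>s \<union> set \<kappa>s" for \<xi>
  proof -
    obtain b where "\<xi> \<noteq> 0" "has_parity b \<xi>"
      using assms(3,4) \<open>\<xi> \<in> _\<close> unfolding misere_monoid_iso_star_iff by blast
    then show "has_parity (misere_outcome \<xi> = Out_P) \<xi>" "\<xi> \<noteq> 0"
      by (auto simp: misere_outcome_has_parity)
  qed
  have N: "has_parity False \<xi>" if "\<xi> \<in> set \<xi>s \<union> set \<kappa>s" "misere_outcome \<xi> = Out_N" for \<xi>
    using par[OF that(1)] that(2) by simp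
  have part1: "misere_monoid (cl {position_of \<xi>s \<kappa>s}) \<cong>\<^sub>o misere_monoid (cl {star})"
    if eq: "\<forall>\<xi>\<in>set \<xi>s. \<forall>\<kappa>\<in>set \<kappa>s. misere_outcome \<xi> = misere_outcome \<kappa>"
  proof -
    let ?b = "misere_outcome (hd \<xi>s) = Out_P"
    \<comment> \<open>The hypothesis compares outcomes only across the two lists; two members of
      \<open>\<xi>s\<close> are compared through a member of the nonempty list
      \<open>\<kappa>s\<close>.\<close>
    have "misere_outcome \<xi> = misere_outcome (hd \<xi>s)" if "\<xi> \<in> set \<xi>s \<union> set \<kappa>s" for \<xi>
      using that eq assms(1,2) by (metis Un_iff hd_in_set)
    then have "has_parity ?b \<xi>" if "\<xi> \<in> set \<xi>s \<union> set \<kappa>s" for \<xi>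
      using par[OF that] that by simp
    then have "has_parity (\<not> ?b) (position_of \<xi>s \<kappa>s)"
      using assms(1,2) by (intro position_of_has_parity) auto
    then show ?thesis
      using assms(1) by (auto simp: misere_monoid_iso_star_iff position_of_eq_zero_iff)
  qed
  have part2: "misere_monoid (cl {position_of \<xi>s []}) \<cong>\<^sub>o misere_monoid (cl {star})"
    if "\<forall>\<xi>\<in>set \<xi>s. misere_outcome \<xi> = Out_P"
  proof -
    \<comment> \<open>All options are odd, so the position is even, and an even position may leave
      Right stuck.\<close>
    have "has_parity False (position_of \<xi>s [])"
      using that par by (intro position_of_has_parity) force+
    then show ?thesis
      using assms(1) by (auto simp: misere_monoid_iso_star_iff position_of_eq_zero_iff)
  qed
  \<comment> \<open>Covers all three shapes at once: \<open>0\<close> is even like the other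
    options, so the position is odd, which requires both lists to be nonempty.\<close>
  have part3: "misere_monoid (cl {position_of ls rs}) \<cong>\<^sub>o misere_monoid (cl {star})"
    if all_N: "\<forall>\<xi>\<in>set \<xi>s. \<forall>\<kappa>\<in>set \<kappa>s. misere_outcome \<xi> = Out_N \<and> misere_outcome \<kappa> = Out_N"
      and "set ls \<union> set rs \<subseteq> set \<xi>s \<union> set \<kappa>s \<union> {0}" and "ls \<noteq> []" "rs \<noteq> []" for ls rs
  proof -
    \<comment> \<open>The hypothesis ranges over pairs, so it says something about one list only
      because the other is nonempty.\<close>
    have "misere_outcome \<xi> = Out_N" if "\<xi> \<in> set \<xi>s \<union> set \<kappa>s" for \<xi>
      using that all_N assms(1,2) by (metis Un_iff hd_in_set)
    then have "has_parity True (position_of ls rs)"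
      using that(2-4) N has_parity_zero by (intro position_of_has_parity) auto
    then show ?thesis
      using that(3) by (auto simp: misere_monoid_iso_star_iff position_of_eq_zero_iff)
  qed
  have part4: "misere_monoid (cl {conjugate \<xi>}) \<cong>\<^sub>o misere_monoid (cl {star})"
    if "\<xi> \<in> set \<xi>s \<union> set \<kappa>s" for \<xi>
    using par[OF that] nonzero[OF that] has_parity_conjugate
    by (auto simp: misere_monoid_iso_star_iff conjugate_eq_zero_iff)
  show ?thesis
  proof (intro conjI impI ballI, goal_cases)
    case 1
    then show ?case by (rule part1)
  next
    case 2
    then show ?case by (rule part2)
  next
    case 3
    then show ?case by (rule part3) (use assms(1) in auto)
  next
    case 4
    then show ?case by (rule part3) (use assms(1) in auto)
  next
    case 5
    then show ?case by (rule part3) auto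
  qed (auto intro: part4)
qed

end
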